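(* Assume that each vote reduces to choosing a single option, and let $f_x$ be the fraction of voters who choose $x$, so that $f_x\ge0$, $\sum_{x\in A}f_x=1$, and the Llull matrix is $v_{xy}=f_x$ for all $x\ne y$. Then the rank-like rates are $$R_x=f_x+(1-f_x)\,N\qquad\text{for every } x\in A .$$
   Context: Let $A$ be a finite set of $N$ options and $\Pi=\{(x,y)\in A\times A : x\neq y\}$; a pair $(x,y)$ is written $xy$. Let $\Omega=\{v\in[0,1]^{\Pi} : v_{xy}+v_{yx}\le 1 \text{ for all } xy\in\Pi\}$; its elements are called Llull matrices. For $v\in\Omega$ put $t_{xy}=v_{xy}+v_{yx}$ (turnouts). CLC procedure applied to $v\in\Omega$: (1) Indirect scores: $v^*_{xy}=\max\min_{0\le i<n} v_{x_ix_{i+1}}$, the maximum being over all paths $x_0x_1\dots x_n$ ($n\ge1$, consecutive elements distinct) in $A$ with $x_0=x$, $x_n=y$. Indirect margins: $m^{\kappa}_{xy}=v^*_{xy}-v^*_{yx}$. (2) Indirect comparison relation: $\kappa=\{xy\in\Pi : m^{\kappa}_{xy}>0\}$ (it is transitive). An admissible order is any strict total order $\xi\subseteq\Pi$ on $A$ with $\kappa\subseteq\xi$. Fix an admissible order $\xi$. Write $x\succ_\xi y$ for $xy\in\xi$, and $x\succeq_\xi y$ for ($xy\in\xi$ or $x=y$). For $x$ not last in $\xi$, $x'$ denotes the immediate successor of $x$ in $\xi$ (the element following $x$). (3) For each non-last $x$: $m^{\sigma}_{xx'}=\min\{m^{\kappa}_{pq} : p\succeq_\xi x,\ x'\succeq_\xi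 q\}$. (4) $(t^{\sigma}_{xy})$ is the unique minimizer of $\sum_{x}\sum_{y\neq x}(\tau_{xy}-t_{xy})^2$ over all $\tau\in\mathbb{R}^{\Pi}$ satisfying: $\tau_{xy}=\tau_{yx}$ for all $xy\in\Pi$; $m^{\sigma}_{xx'}\le\tau_{xx'}\le1$ for all non-last $x$; and $0\le\tau_{xz}-\tau_{x'z}\le m^{\sigma}_{xx'}$ for all non-last $x$ and all $z\notin\{x,x'\}$. (5) Projected scores: $v^{\pi}_{xx'}=(t^{\sigma}_{xx'}+m^{\sigma}_{xx'})/2$, $v^{\pi}_{x'x}=(t^{\sigma}_{xx'}-m^{\sigma}_{xx'})/2$, and for $x\succ_\xi y$: $v^{\pi}_{xy}=\max\{v^{\pi}_{pp'} : x\succeq_\xi p\succ_\xi y\}$, $v^{\pi}_{yx}=\min\{v^{\pi}_{p'p} : x\succeq_\xi p\succ_\xi y\}$. (6) Rank-like rates: $R_x=N-\sum_{y\neq x}v^{\pi}_{xy}$. The projected scores and rank-like rates do not depend on the choice of the admissible order $\xi$, so they are functions of $v$. *)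

theory Defs
  imports Complex_Main "HOL-Library.FuncSet"
begin

definition ordered_pairs :: "'a set \<Rightarrow> ('a \<times> 'a) set" where
  "ordered_pairs A = {(x, y). x \<in> A \<and> y \<in> A \<and> x \<noteq> y}"

text \<open>Matrices indexed by ordered pairs are functions \<open>'a \<times> 'a \<Rightarrow> real\<close>; only their values on
  \<^term>\<open>ordered_pairs A\<close> are ever used.\<close>

definition llull_matrix :: "'a set \<Rightarrow> ('a \<times> 'a \<Rightarrow> real) \<Rightarrow> bool" where
  "llull_matrix A v \<longleftrightarrow>
     (\<forall>(x, y) \<in> ordered_pairs A. 0 \<le> v (x, y) \<and> v (x, y) \<le> 1 \<and> v (x, y) + v (y, x) \<le> 1)"

definition turnout :: "('a \<times> 'a \<Rightarrow> real) \<Rightarrow> 'a \<times> 'a \<Rightarrow> real" where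
  "turnout v = (\<lambda>(x, y). v (x, y) + v (y, x))"

definition is_vote_path :: "'a set \<Rightarrow> 'a \<Rightarrow> 'a \<Rightarrow> 'a list \<Rightarrow> bool" where
  "is_vote_path A x y p \<longleftrightarrow>
     2 \<le> length p \<and> hd p = x \<and> last p = y \<and> set p \<subseteq> A \<and>
     (\<forall>i. Suc i < length p \<longrightarrow> p ! i \<noteq> p ! Suc i)"

definition path_strength :: "('a \<times> 'a \<Rightarrow> real) \<Rightarrow> 'a list \<Rightarrow> real" where
  "path_strength v p = Min {v (p ! i, p ! Suc i) | i. Suc i < length p}"

text \<open>There are infinitely many paths, but for finite \<open>A\<close> only finitely many strengths, so that
  \<^const>\<open>Max\<close> is meaningful here.\<close>

definition indirect_score :: "'a set \<Rightarrow> ('a \<times> 'a \<Rightarrow> real) \<Rightarrow> 'a \<times> 'a \<Rightarrow> real" where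
  "indirect_score A v = (\<lambda>(x, y). Max {path_strength v p | p. is_vote_path A x y p})"

definition indirect_margin :: "'a set \<Rightarrow> ('a \<times> 'a \<Rightarrow> real) \<Rightarrow> 'a \<times> 'a \<Rightarrow> real" where
  "indirect_margin A v = (\<lambda>(x, y). indirect_score A v (x, y) - indirect_score A v (y, x))"

definition indirect_comparison :: "'a set \<Rightarrow> ('a \<times> 'a \<Rightarrow> real) \<Rightarrow> 'a rel" where
  "indirect_comparison A v = {(x, y) \<in> ordered_pairs A. indirect_margin A v (x, y) > 0}"

definition admissible_order :: "'a set \<Rightarrow> ('a \<times> 'a \<Rightarrow> real) \<Rightarrow> 'a rel \<Rightarrow> bool" where
  "admissible_order A v \<xi> \<longleftrightarrow>
     \<xi> \<subseteq> ordered_pairs A \<and> strict_linear_order_on A \<xi> \<and> indirect_comparison A v \<subseteq> \<xi>"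

text \<open>In the following, \<open>(x, y) \<in> \<xi>\<close> means that \<open>x\<close> precedes \<open>y\<close>.\<close>

definition non_last :: "'a rel \<Rightarrow> 'a set" where
  "non_last \<xi> = {x. \<exists>y. (x, y) \<in> \<xi>}"

definition nxt :: "'a rel \<Rightarrow> 'a \<Rightarrow> 'a" where
  "nxt \<xi> x = (THE y. (x, y) \<in> \<xi> \<and> \<not> (\<exists>z. (x, z) \<in> \<xi> \<and> (z, y) \<in> \<xi>))"

text \<open>The quantities \<open>m\<^sup>\<sigma>\<^bsub>xx'\<^esub>\<close>, \<open>v\<^sup>\<pi>\<^bsub>xx'\<^esub>\<close> and \<open>v\<^sup>\<pi>\<^bsub>x'x\<^esub>\<close> attached to consecutive options are
  indexed by the non-last option \<open>x\<close> alone.\<close>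

definition superdiagonal_margin ::
    "'a set \<Rightarrow> ('a \<times> 'a \<Rightarrow> real) \<Rightarrow> 'a rel \<Rightarrow> 'a \<Rightarrow> real" where
  "superdiagonal_margin A v \<xi> x =
     Min {indirect_margin A v (p, q) | p q. (p, x) \<in> \<xi>\<^sup>= \<and> (nxt \<xi> x, q) \<in> \<xi>\<^sup>=}"

text \<open>The elements of \<open>\<real>\<^sup>\<Pi>\<close> are the functions that are extensional on \<^term>\<open>ordered_pairs A\<close>;
  without this the minimizer could not be unique.\<close>

definition feasible_turnouts ::
    "'a set \<Rightarrow> ('a \<times> 'a \<Rightarrow> real) \<Rightarrow> 'a rel \<Rightarrow> ('a \<times> 'a \<Rightarrow> real) set" where
  "feasible_turnouts A v \<xi> = {\<tau> \<in> extensional (ordered_pairs A).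
     (\<forall>(x, y) \<in> ordered_pairs A. \<tau> (x, y) = \<tau> (y, x)) \<and>
     (\<forall>x \<in> non_last \<xi>. superdiagonal_margin A v \<xi> x \<le> \<tau> (x, nxt \<xi> x) \<and> \<tau> (x, nxt \<xi> x) \<le> 1) \<and>
     (\<forall>x \<in> non_last \<xi>. \<forall>z \<in> A - {x, nxt \<xi> x}.
        0 \<le> \<tau> (x, z) - \<tau> (nxt \<xi> x, z) \<and>
        \<tau> (x, z) - \<tau> (nxt \<xi> x, z) \<le> superdiagonal_margin A v \<xi> x)}"

definition projected_turnout ::
    "'a set \<Rightarrow> ('a \<times> 'a \<Rightarrow> real) \<Rightarrow> 'a rel \<Rightarrow> 'a \<times> 'a \<Rightarrow> real" where
  "projected_turnout A v \<xi> =
     (THE \<tau>. is_arg_min (\<lambda>\<tau>. \<Sum>x\<in>A. \<Sum>y\<in>A - {x}. (\<tau> (x, y) - turnout v (x, y))\<^sup>2)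
              (\<lambda>\<tau>. \<tau> \<in> feasible_turnouts A v \<xi>) \<tau>)"

definition upper_score :: "'a set \<Rightarrow> ('a \<times> 'a \<Rightarrow> real) \<Rightarrow> 'a rel \<Rightarrow> 'a \<Rightarrow> real" where
  "upper_score A v \<xi> x =
     (projected_turnout A v \<xi> (x, nxt \<xi> x) + superdiagonal_margin A v \<xi> x) / 2"

definition lower_score :: "'a set \<Rightarrow> ('a \<times> 'a \<Rightarrow> real) \<Rightarrow> 'a rel \<Rightarrow> 'a \<Rightarrow> real" where
  "lower_score A v \<xi> x =
     (projected_turnout A v \<xi> (x, nxt \<xi> x) - superdiagonal_margin A v \<xi> x) / 2"

text \<open>On consecutive options the maximum and minimum below range over a single value, so this agrees
  with \<^const>\<open>upper_score\<close> and \<^const>\<open>lower_score\<close>.\<close>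

definition projected_score ::
    "'a set \<Rightarrow> ('a \<times> 'a \<Rightarrow> real) \<Rightarrow> 'a rel \<Rightarrow> 'a \<times> 'a \<Rightarrow> real" where
  "projected_score A v \<xi> = (\<lambda>(x, y).
     if (x, y) \<in> \<xi> then Max {upper_score A v \<xi> p | p. (x, p) \<in> \<xi>\<^sup>= \<and> (p, y) \<in> \<xi>}
     else Min {lower_score A v \<xi> p | p. (y, p) \<in> \<xi>\<^sup>= \<and> (p, x) \<in> \<xi>})"

definition rank_like_rate :: "'a set \<Rightarrow> ('a \<times> 'a \<Rightarrow> real) \<Rightarrow> 'a rel \<Rightarrow> 'a \<Rightarrow> real" where
  "rank_like_rate A v \<xi> x = real (card A) - (\<Sum>y\<in>A - {x}. projected_score A v \<xi> (x, y))"

end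

(* With plurality votes a path has at most the strength f x of its first link, so the indirect scores
   equal v and the indirect margins are f x - f y. An admissible order is then non-increasing in f,
   the superdiagonal margins are f x - f x', and the turnouts f x + f y already satisfy all
   constraints of the projection. Hence the projection changes nothing: the projected score of every
   pair (x, y) is f x. *)
theory Submission
  imports Defs
begin

section \<open>Neighbours in a finite strict linear order\<close>

lemma strict_linear_order_immediate_successor:
  assumes "finite A" "\<xi> \<subseteq> A \<times> A" "strict_linear_order_on A \<xi>" "(x, w) \<in> \<xi>"
  shows "\<exists>!y. (x, y) \<in> \<xi> \<and> \<not> (\<exists>z. (x, z) \<in> \<xi> \<and> (z, y) \<in> \<xi>)"
proof -
  have tr: "trans \<xi>" and ir: "irrefl \<xi>" and tot: "total_on A \<xi>"
    using assms(3) by (auto simp: strict_linear_order_on_def)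
  have "finite \<xi>"
    using assms(1,2) by (meson finite_SigmaI finite_subset)
  \<comment> \<open>Finiteness makes the order well-founded, so the set of elements after
    \<open>x\<close> has a minimal one; totality later makes it unique.\<close>
  then have wf_order: "wf \<xi>"
    using tr ir by (simp add: finite_acyclic_wf acyclic_irrefl)
  have "w \<in> {y. (x, y) \<in> \<xi>}" using assms(4) by simp
  with wf_order obtain y where y: "(x, y) \<in> \<xi>" "\<And>z. (z, y) \<in> \<xi> \<Longrightarrow> (x, z) \<notin> \<xi>"
    by (rule wfE_min) simp
  show ?thesis
  proof (intro ex1I)
    show "(x, y) \<in> \<xi> \<and> \<not> (\<exists>z. (x, z) \<in> \<xi> \<and> (z, y) \<in> \<xi>)"
      using y by blast
  next
    fix y' assume y': "(x, y') \<in> \<xi> \<and> \<not> (\<exists>z. (x, z) \<in> \<xi> \<and> (z, y') \<in> \<xi>)"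
    have "y \<in> A" "y' \<in> A" using y(1) y' assms(2) by auto
    then show "y' = y"
      using tot y y' unfolding total_on_def by metis
  qed
qed

lemma strict_linear_order_nxt:
  assumes "finite A" "\<xi> \<subseteq> A \<times> A" "strict_linear_order_on A \<xi>" "(x, y) \<in> \<xi>"
  shows "(x, nxt \<xi> x) \<in> \<xi>" and "(nxt \<xi> x, y) \<in> \<xi>\<^sup>="
proof -
  have *: "(x, nxt \<xi> x) \<in> \<xi> \<and> \<not> (\<exists>z. (x, z) \<in> \<xi> \<and> (z, nxt \<xi> x) \<in> \<xi>)"
    unfolding nxt_def by (rule theI', rule strict_linear_order_immediate_successor[OF assms])
  then show "(x, nxt \<xi> x) \<in> \<xi>" by blast
  have "total_on A \<xi>" using assms(3) by (auto simp: strict_linear_order_on_def)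
  moreover have "nxt \<xi> x \<in> A" "y \<in> A" using * assms(2,4) by auto
  ultimately show "(nxt \<xi> x, y) \<in> \<xi>\<^sup>="
    using * assms(4) unfolding total_on_def by (metis UnI1 UnI2 pair_in_Id_conv)
qed

text \<open>A minimal element for the converse relation among those before \<open>y\<close> has
  nothing between itself and \<open>y\<close>. This supplies the index at which the minimum in a
  projected score is attained.\<close>

lemma strict_linear_order_immediate_predecessor:
  assumes "finite A" "\<xi> \<subseteq> A \<times> A" "strict_linear_order_on A \<xi>" "(x, y) \<in> \<xi>"
  obtains p where "(x, p) \<in> \<xi>\<^sup>=" "(p, y) \<in> \<xi>" "nxt \<xi> p = y"
proof -
  have tr: "trans \<xi>" and ir: "irrefl \<xi>" and tot: "total_on A \<xi>"
    using assms(3) by (auto simp: strict_linear_order_on_def)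
  have "finite \<xi>"
    using assms(1,2) by (meson finite_SigmaI finite_subset)
  then have wf_order: "wf (\<xi>\<inverse>)"
    using tr ir by (simp add: finite_acyclic_wf_converse acyclic_irrefl)
  have "x \<in> {p. (p, y) \<in> \<xi>}" using assms(4) by simp
  with wf_order obtain p where p: "(p, y) \<in> \<xi>" "\<And>z. (p, z) \<in> \<xi> \<Longrightarrow> (z, y) \<notin> \<xi>"
    by (rule wfE_min) simp
  have "nxt \<xi> p = y"
    using strict_linear_order_nxt[OF assms(1-3) p(1)] p(2) by blast
  moreover have "x \<in> A" "p \<in> A" using p(1) assms(2,4) by auto
  then have "(x, p) \<in> \<xi>\<^sup>="
    using tot assms(4) p(2) unfolding total_on_def by (metis UnI1 UnI2 pair_in_Id_conv)
  ultimately show thesis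
    using that p(1) by blast
qed

text \<open>The bound \<open>score_sum_le_1\<close> is what the constraint that turnouts of
  consecutive options be at most 1 asks for.\<close>

locale plurality_voting =
  fixes A :: "'a set" and f :: "'a \<Rightarrow> real" and v :: "'a \<times> 'a \<Rightarrow> real" and \<xi> :: "'a rel"
  assumes finite_alternatives: "finite A"
    and fraction_nonneg: "\<And>x. x \<in> A \<Longrightarrow> 0 \<le> f x"
    and score_eq: "\<And>x y. (x, y) \<in> ordered_pairs A \<Longrightarrow> v (x, y) = f x"
    and score_sum_le_1: "\<And>x y. (x, y) \<in> ordered_pairs A \<Longrightarrow> f x + f y \<le> 1"
    and admissible: "admissible_order A v \<xi>"
begin

section \<open>Order facts, indirect scores and margins for plurality votes\<close>

lemma order_subset: "\<xi> \<subseteq> ordered_pairs A" "\<xi> \<subseteq> A \<times> A"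
  and linear_order: "strict_linear_order_on A \<xi>"
  using admissible by (auto simp: admissible_order_def ordered_pairs_def)

lemma order_trans: "(x, y) \<in> \<xi> \<Longrightarrow> (y, z) \<in> \<xi> \<Longrightarrow> (x, z) \<in> \<xi>"
  and order_asym: "(x, y) \<in> \<xi> \<Longrightarrow> (y, x) \<notin> \<xi>"
  and order_total: "x \<in> A \<Longrightarrow> y \<in> A \<Longrightarrow> x \<noteq> y \<Longrightarrow> (x, y) \<in> \<xi> \<or> (y, x) \<in> \<xi>"
  using linear_order
  by (auto simp: strict_linear_order_on_def total_on_def irrefl_def dest: transD)

lemmas nxt_in_order = strict_linear_order_nxt(1)[OF finite_alternatives order_subset(2) linear_order]
lemmas nxt_least = strict_linear_order_nxt(2)[OF finite_alternatives order_subset(2) linear_order]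
lemmas immediate_predecessor =
  strict_linear_order_immediate_predecessor[OF finite_alternatives order_subset(2) linear_order]

lemma path_strength_bounds:
  assumes "is_vote_path A x y p"
  shows "path_strength v p \<in> f ` A" and "path_strength v p \<le> f x"
proof -
  let ?S = "{v (p ! i, p ! Suc i) | i. Suc i < length p}"
  have fin: "finite ?S"
    using finite_image_set[of "\<lambda>i. Suc i < length p" "\<lambda>i. v (p ! i, p ! Suc i)"]
    by (simp add: finite_subset[of "{i. Suc i < length p}" "{..<length p}"] subset_iff)
  have link: "p ! i \<in> A \<and> v (p ! i, p ! Suc i) = f (p ! i)" if "Suc i < length p" for i
  proof -
    have "p ! i \<in> A" "p ! Suc i \<in> A" "p ! i \<noteq> p ! Suc i"
      using assms that by (auto simp: is_vote_path_def subset_iff)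
    then show ?thesis using score_eq by (simp add: ordered_pairs_def)
  qed
  have len: "Suc 0 < length p" and hd: "p ! 0 = x"
    using assms by (cases p; auto simp: is_vote_path_def)+
  then have first: "f x \<in> ?S"
    using link[OF len] by (metis (mono_tags, lifting) mem_Collect_eq)
  show "path_strength v p \<le> f x"
    unfolding path_strength_def using fin first by (rule Min_le)
  have "Min ?S \<in> ?S" using fin first by (intro Min_in) auto
  then show "path_strength v p \<in> f ` A"
    unfolding path_strength_def using link by fastforce
qed

lemma indirect_score_eq:
  assumes "(x, y) \<in> ordered_pairs A"
  shows "indirect_score A v (x, y) = f x"
proof -
  let ?S = "{path_strength v p | p. is_vote_path A x y p}"
  have "?S \<subseteq> f ` A" using path_strength_bounds(1) by blast
  then have fin: "finite ?S" using finite_alternatives finite_subset by blast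
  \<comment> \<open>The one-link path attains the upper bound \<open>f x\<close>.\<close>
  have path: "is_vote_path A x y [x, y]"
    using assms by (auto simp: is_vote_path_def ordered_pairs_def)
  have "{v ([x, y] ! i, [x, y] ! Suc i) | i. Suc i < length [x, y]} = {v (x, y)}"
    by auto
  then have "path_strength v [x, y] = f x"
    using score_eq[OF assms] unfolding path_strength_def by simp
  with path have "f x \<in> ?S" by force
  with fin have "Max ?S = f x"
    using path_strength_bounds(2) by (intro Max_eqI) auto
  then show ?thesis by (simp add: indirect_score_def)
qed

lemma indirect_margin_eq:
  assumes "(x, y) \<in> ordered_pairs A"
  shows "indirect_margin A v (x, y) = f x - f y"
proof -
  have "(y, x) \<in> ordered_pairs A" using assms by (auto simp: ordered_pairs_def)
  then show ?thesis using assms by (simp add: indirect_margin_def indirect_score_eq)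
qed

text \<open>Otherwise the margin of \<open>y\<close> over \<open>x\<close> would be positive and
  admissibility would put \<open>y\<close> before \<open>x\<close>. The reflexive closure matches
  the index ranges of the later minima and maxima.\<close>

lemma fraction_antimono:
  assumes "(x, y) \<in> \<xi>\<^sup>="
  shows "f y \<le> f x"
proof (rule ccontr)
  assume "\<not> f y \<le> f x"
  with assms have xy: "(x, y) \<in> \<xi>" by auto
  then have "(y, x) \<in> ordered_pairs A" using order_subset by (auto simp: ordered_pairs_def)
  then have "(y, x) \<in> indirect_comparison A v"
    using \<open>\<not> f y \<le> f x\<close> by (simp add: indirect_comparison_def indirect_margin_eq)
  then show False
    using admissible order_asym[OF xy] by (auto simp: admissible_order_def)
qed

text \<open>Moving \<open>p\<close> up from \<open>x\<close> or \<open>q\<close> down from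
  \<open>nxt \<xi> x\<close> can only increase \<open>f p - f q\<close>, so the minimum sits at the
  consecutive pair itself.\<close>

lemma superdiagonal_margin_eq:
  assumes "x \<in> non_last \<xi>"
  shows "superdiagonal_margin A v \<xi> x = f x - f (nxt \<xi> x)"
proof -
  let ?S = "{indirect_margin A v (p, q) | p q. (p, x) \<in> \<xi>\<^sup>= \<and> (nxt \<xi> x, q) \<in> \<xi>\<^sup>=}"
  have nxt: "(x, nxt \<xi> x) \<in> \<xi>"
    using assms nxt_in_order by (auto simp: non_last_def)
  \<comment> \<open>The strict step from \<open>x\<close> to its successor keeps \<open>p\<close>
    and \<open>q\<close> distinct, so the margin formula covers every competitor.\<close>
  have pair: "(p, q) \<in> \<xi>" if "(p, x) \<in> \<xi>\<^sup>=" "(nxt \<xi> x, q) \<in> \<xi>\<^sup>=" for p q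
    using that nxt order_trans by blast
  have margin: "indirect_margin A v (p, q) = f p - f q" if "(p, q) \<in> \<xi>" for p q
    using that order_subset indirect_margin_eq by blast
  have "?S \<subseteq> indirect_margin A v ` \<xi>" using pair by blast
  moreover have "finite \<xi>"
    using finite_alternatives order_subset(2) by (meson finite_SigmaI finite_subset)
  ultimately have fin: "finite ?S" using finite_surj by blast
  have "Min ?S = f x - f (nxt \<xi> x)"
  proof (rule Min_eqI[OF fin])
    fix m assume "m \<in> ?S"
    then obtain p q where pq: "(p, x) \<in> \<xi>\<^sup>=" "(nxt \<xi> x, q) \<in> \<xi>\<^sup>="
      and m: "m = indirect_margin A v (p, q)" by blast
    show "f x - f (nxt \<xi> x) \<le> m"
      unfolding m margin[OF pair[OF pq]]
      using fraction_antimono[OF pq(1)] fraction_antimono[OF pq(2)] by linarith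
  next
    show "f x - f (nxt \<xi> x) \<in> ?S"
      using margin[OF nxt, symmetric] by blast
  qed
  then show ?thesis by (simp add: superdiagonal_margin_def)
qed

section \<open>Projection of the turnouts\<close>

lemma turnout_eq:
  assumes "(x, y) \<in> ordered_pairs A"
  shows "turnout v (x, y) = f x + f y"
proof -
  have "(y, x) \<in> ordered_pairs A" using assms by (auto simp: ordered_pairs_def)
  then show ?thesis using assms by (simp add: turnout_def score_eq)
qed

text \<open>For every \<open>z\<close> the difference of turnouts is
  \<open>f x - f (nxt \<xi> x)\<close>, exactly the superdiagonal margin, so its upper bound is
  tight. Restriction makes the matrix extensional, as membership demands.\<close>

lemma turnout_feasible:
  "restrict (turnout v) (ordered_pairs A) \<in> feasible_turnouts A v \<xi>"
proof -
  let ?t = "restrict (turnout v) (ordered_pairs A)"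
  have t: "?t (x, y) = f x + f y" if "(x, y) \<in> ordered_pairs A" for x y
    using that turnout_eq by simp
  have "?t (x, y) = ?t (y, x)" if "(x, y) \<in> ordered_pairs A" for x y
  proof -
    have "(y, x) \<in> ordered_pairs A" using that by (auto simp: ordered_pairs_def)
    then show ?thesis using t that by simp
  qed
  moreover have "superdiagonal_margin A v \<xi> x \<le> ?t (x, nxt \<xi> x) \<and> ?t (x, nxt \<xi> x) \<le> 1 \<and>
      (\<forall>z \<in> A - {x, nxt \<xi> x}. 0 \<le> ?t (x, z) - ?t (nxt \<xi> x, z) \<and>
        ?t (x, z) - ?t (nxt \<xi> x, z) \<le> superdiagonal_margin A v \<xi> x)" if "x \<in> non_last \<xi>" for x
  proof -
    have nxt: "(x, nxt \<xi> x) \<in> \<xi>"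
      using that nxt_in_order by (auto simp: non_last_def)
    then have pair: "(x, nxt \<xi> x) \<in> ordered_pairs A" using order_subset by blast
    then have mem: "x \<in> A" "nxt \<xi> x \<in> A" by (auto simp: ordered_pairs_def)
    have diff: "?t (x, z) - ?t (nxt \<xi> x, z) = f x - f (nxt \<xi> x)" if "z \<in> A - {x, nxt \<xi> x}" for z
    proof -
      have "(x, z) \<in> ordered_pairs A" "(nxt \<xi> x, z) \<in> ordered_pairs A"
        using that mem by (auto simp: ordered_pairs_def)
      then show ?thesis using t by simp
    qed
    have "f (nxt \<xi> x) \<le> f x" using nxt fraction_antimono by blast
    then show ?thesis
      using diff t[OF pair] score_sum_le_1[OF pair] fraction_nonneg[OF mem(2)]
      by (simp add: superdiagonal_margin_eq[OF that])
  qed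
  ultimately show ?thesis
    unfolding feasible_turnouts_def by auto
qed

text \<open>A feasible point at distance zero is a minimizer, and any other minimizer must also have
  distance zero.\<close>

lemma projected_turnout_eq:
  "projected_turnout A v \<xi> = restrict (turnout v) (ordered_pairs A)"
proof -
  let ?t = "restrict (turnout v) (ordered_pairs A)"
  let ?F = "feasible_turnouts A v \<xi>"
  let ?D = "\<lambda>\<tau>. \<Sum>x\<in>A. \<Sum>y\<in>A - {x}. (\<tau> (x, y) - turnout v (x, y))\<^sup>2"
  have D_nonneg: "0 \<le> ?D \<tau>" for \<tau>
    by (intro sum_nonneg) simp
  have D_t: "?D ?t = 0"
    by (intro sum.neutral ballI) (auto simp: ordered_pairs_def)
  have "is_arg_min ?D (\<lambda>\<tau>. \<tau> \<in> ?F) ?t"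
    unfolding is_arg_min_def D_t using turnout_feasible D_nonneg by (simp add: not_less)
  moreover have "\<tau> = ?t" if "is_arg_min ?D (\<lambda>\<tau>. \<tau> \<in> ?F) \<tau>" for \<tau>
  proof -
    have feasible: "\<tau> \<in> ?F" and "\<not> ?D ?t < ?D \<tau>"
      using that turnout_feasible unfolding is_arg_min_def by blast+
    then have D0: "?D \<tau> = 0"
      using D_nonneg[of \<tau>] unfolding D_t by linarith
    \<comment> \<open>A vanishing sum of nonnegative terms has only zero terms; this is applied to
      the outer sum here and to the inner sums next.\<close>
    have "\<forall>x\<in>A. (\<Sum>y\<in>A - {x}. (\<tau> (x, y) - turnout v (x, y))\<^sup>2) = 0"
      using D0 by (subst (asm) sum_nonneg_eq_0_iff) (auto intro: finite_alternatives sum_nonneg)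
    then have "\<tau> (x, y) = turnout v (x, y)" if "x \<in> A" "y \<in> A - {x}" for x y
      using that finite_alternatives by (simp add: sum_nonneg_eq_0_iff)
    then have "\<tau> e = ?t e" if "e \<in> ordered_pairs A" for e
      using that by (auto simp: ordered_pairs_def)
    \<comment> \<open>Agreement on pairs becomes equality of functions because both are
      \<open>undefined\<close> elsewhere.\<close>
    moreover have "\<tau> \<in> extensional (ordered_pairs A)"
      using feasible by (simp add: feasible_turnouts_def)
    ultimately show ?thesis
      by (meson extensionalityI restrict_extensional)
  qed
  ultimately show ?thesis
    unfolding projected_turnout_def by (intro the_equality)
qed

section \<open>Projected scores\<close>

lemma upper_score_eq: "x \<in> non_last \<xi> \<Longrightarrow> upper_score A v \<xi> x = f x"
  and lower_score_eq: "x \<in> non_last \<xi> \<Longrightarrow> lower_score A v \<xi> x = f (nxt \<xi> x)"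
proof -
  assume x: "x \<in> non_last \<xi>"
  then have "(x, nxt \<xi> x) \<in> ordered_pairs A"
    using nxt_in_order order_subset by (auto simp: non_last_def)
  then have "projected_turnout A v \<xi> (x, nxt \<xi> x) = f x + f (nxt \<xi> x)"
    by (simp add: projected_turnout_eq turnout_eq)
  with x show "upper_score A v \<xi> x = f x" "lower_score A v \<xi> x = f (nxt \<xi> x)"
    by (simp_all add: upper_score_def lower_score_def superdiagonal_margin_eq)
qed

text \<open>Since \<open>f\<close> does not increase along the order, the maximum of
  \<open>f p\<close> from \<open>x\<close> on is attained at \<open>p = x\<close>. In the other
  direction the minimum runs over \<open>f (nxt \<xi> p)\<close>, where \<open>nxt \<xi> p\<close>
  reaches down to \<open>x\<close> itself.\<close>

lemma projected_score_eq:
  assumes "(x, y) \<in> ordered_pairs A"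
  shows "projected_score A v \<xi> (x, y) = f x"
proof (cases "(x, y) \<in> \<xi>")
  case True
  let ?S = "{upper_score A v \<xi> p | p. (x, p) \<in> \<xi>\<^sup>= \<and> (p, y) \<in> \<xi>}"
  have upper: "upper_score A v \<xi> p = f p" if "(p, y) \<in> \<xi>" for p
    using that upper_score_eq by (auto simp: non_last_def)
  have "?S \<subseteq> upper_score A v \<xi> ` A" using order_subset(2) by blast
  then have "finite ?S" using finite_alternatives finite_surj by blast
  then have "Max ?S = f x"
  proof (rule Max_eqI)
    show "f x \<in> ?S" using True upper[OF True] by force
  qed (use upper fraction_antimono in auto)
  with True show ?thesis by (simp add: projected_score_def)
next
  case False
  then have yx: "(y, x) \<in> \<xi>" using assms order_total by (auto simp: ordered_pairs_def)
  let ?S = "{lower_score A v \<xi> p | p. (y, p) \<in> \<xi>\<^sup>= \<and> (p, x) \<in> \<xi>}"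
  have lower: "lower_score A v \<xi> p = f (nxt \<xi> p)" if "(p, x) \<in> \<xi>" for p
    using that lower_score_eq by (auto simp: non_last_def)
  have "?S \<subseteq> lower_score A v \<xi> ` A" using order_subset(2) by blast
  then have "finite ?S" using finite_alternatives finite_surj by blast
  then have "Min ?S = f x"
  proof (rule Min_eqI)
    fix s assume "s \<in> ?S"
    then obtain p where "(p, x) \<in> \<xi>" "s = lower_score A v \<xi> p" by blast
    then show "f x \<le> s" using lower fraction_antimono[OF nxt_least] by simp
  next
    \<comment> \<open>The minimum is attained at the immediate predecessor of \<open>x\<close>,
      whose lower score is \<open>f x\<close>.\<close>
    obtain p where p: "(y, p) \<in> \<xi>\<^sup>=" "(p, x) \<in> \<xi>" "nxt \<xi> p = x"
      using immediate_predecessor[OF yx] .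
    then have "f x = lower_score A v \<xi> p" using lower by simp
    with p show "f x \<in> ?S" by blast
  qed
  with False show ?thesis by (simp add: projected_score_def)
qed

end

theorem mainTheorem7:
  fixes A :: "'a set" and f :: "'a \<Rightarrow> real" and v :: "'a \<times> 'a \<Rightarrow> real" and \<xi> :: "'a rel" and x :: 'a
  assumes "finite A"
    and "\<And>x. x \<in> A \<Longrightarrow> 0 \<le> f x"
    and "(\<Sum>x\<in>A. f x) = 1"
    and "llull_matrix A v"
    and "\<And>x y. (x, y) \<in> ordered_pairs A \<Longrightarrow> v (x, y) = f x"
    and "admissible_order A v \<xi>"
    and "x \<in> A"
  shows "rank_like_rate A v \<xi> x = f x + (1 - f x) * real (card A)"
proof -
  \<comment> \<open>This is the Llull condition \<open>v (x, y) + v (y, x) \<le> 1\<close> rewritten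
    in fractions.\<close>
  have "f x + f y \<le> 1" if "(x, y) \<in> ordered_pairs A" for x y
  proof -
    have "(y, x) \<in> ordered_pairs A" using that by (auto simp: ordered_pairs_def)
    then show ?thesis
      using that assms(4) assms(5)[of x y] assms(5)[of y x] by (auto simp: llull_matrix_def)
  qed
  then interpret plurality_voting A f v \<xi>
    using assms by unfold_locales
  have "(\<Sum>y\<in>A - {x}. projected_score A v \<xi> (x, y)) = (\<Sum>y\<in>A - {x}. f x)"
    using assms(7) by (intro sum.cong refl projected_score_eq) (auto simp: ordered_pairs_def)
  \<comment> \<open>\<open>card.remove\<close> gives the number of opponents as a successor
    equation, avoiding truncated subtraction on naturals.\<close>
  also have "\<dots> = (real (card A) - 1) * f x"
    using card.remove[OF assms(1,7)] by simp
  finally show ?thesis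
    by (simp add: rank_like_rate_def algebra_simps)
qed

end
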